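(* Uniqueness of the Doob–Meyer decomposition on optional sets of interval type can fail when the set is not predictable. That is: there exist a complete filtered probability space $(\Omega,\mathcal{F},\{\mathcal{F}_t\},P)$ satisfying the usual conditions, an optional set of interval type $B\subset\Omega\times[0,\infty)$ which is not a predictable set, and a process $Y\in(\mathcal{S}_p)^B$ that admits two different (not indistinguishable on $B$) decompositions $Y=M+A=M'+A'$ on $B$, with $M,M'\in(\mathcal{M}_{loc})^B$ and $A,A'\in(\mathcal{A}_{loc,0})^B$, where $A$ and $A'$ are each restrictions to $B$ of predictable processes.
   Context: A subset $B\subset\Omega\times[0,\infty)$ is a set of interval type if there is a nonnegative random variable $T$ such that for each $\omega$ the section $B_\omega$ is nonempty and equals either $[0,T(\omega)[$ or $[0,T(\omega)]$. It is an optional (resp. predictable) set of interval type if moreover it is an optional (resp. predictable) set. For a class $\mathcal{D}$ of processes and an optional set of interval type $B$, a process $Y$ defined on $B$ belongs to $\mathcal{D}^B$ if there exist an increasing sequence of stopping times $T_n\uparrow T$ ($T$ the debut of $B^c$) and processes $Y^n\in\mathcal{D}$ such that $\bigcup_n[\![0,T_n]\!]\supset B$ and $(Y1_B)_{t\wedge T_n}=(Y^n1_B)_{t\wedge T_n}$ for each $n$ and $t>0$. Here $\mathcal{S}_p$ is the class of special semimartingales, $\mathcal{M}_{loc}$ the class of local martingales, and $\mathcal{A}_{loc,0}$ the class of adapted processes with locally integrable variation and null initial value. *)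

theory Defs
  imports "HOL-Probability.Probability"
begin

section \<open>Filtered probability spaces\<close>

text \<open>
  Times of a process are reals \<open>t \<ge> 0\<close>; values of a process \<open>X :: real \<Rightarrow> 'a \<Rightarrow> real\<close> at negative
  times are never looked at. Filtrations are indexed by \<open>[0,\<infinity>]\<close> (type \<^typ>\<open>ennreal\<close>), so that the
  library predicate \<^const>\<open>stopping_time\<close> covers stopping times with the value \<open>\<infinity>\<close>; its
  condition at \<open>\<infinity>\<close> is void, and apart from being a sub-\<open>\<sigma>\<close>-algebra containing
  all \<open>F t\<close>, the \<open>\<sigma>\<close>-algebra \<open>F \<infinity>\<close> plays no role.
\<close>

locale usual_filtered_prob_space =
  prob_space P + complete_measure P + filtration "space P" F
  for P :: "'a measure" and F :: "ennreal \<Rightarrow> 'a measure" +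
  assumes subalgebra_F: "\<And>t. subalgebra P (F t)"
    and null_sets_F: "null_sets P \<subseteq> sets (F 0)"
    and right_continuous_F: "\<And>t. t < \<infinity> \<Longrightarrow> (\<Inter>s\<in>{t<..}. sets (F s)) = sets (F t)"

type_synonym 'a process = "real \<Rightarrow> 'a \<Rightarrow> real"

definition adapted :: "(ennreal \<Rightarrow> 'a measure) \<Rightarrow> 'a process \<Rightarrow> bool" where
  "adapted F X \<longleftrightarrow> (\<forall>t\<ge>0. X t \<in> borel_measurable (F (ennreal t)))"

definition cadlag :: "'a measure \<Rightarrow> 'a process \<Rightarrow> bool" where
  "cadlag P X \<longleftrightarrow> (\<forall>\<omega>\<in>space P.
     (\<forall>t\<ge>0. continuous (at_right t) (\<lambda>s. X s \<omega>)) \<and>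
     (\<forall>t>0. \<exists>l. ((\<lambda>s. X s \<omega>) \<longlongrightarrow> l) (at_left t)))"

definition left_continuous :: "'a measure \<Rightarrow> 'a process \<Rightarrow> bool" where
  "left_continuous P X \<longleftrightarrow> (\<forall>\<omega>\<in>space P. \<forall>t>0. continuous (at_left t) (\<lambda>s. X s \<omega>))"

definition optional_sigma :: "'a measure \<Rightarrow> (ennreal \<Rightarrow> 'a measure) \<Rightarrow> ('a \<times> real) measure" where
  "optional_sigma P F = sigma (space P \<times> {0..})
     {(\<lambda>(\<omega>, t). X t \<omega>) -` E \<inter> (space P \<times> {0..}) | X E.
        adapted F X \<and> cadlag P X \<and> E \<in> sets borel}"

definition predictable_sigma :: "'a measure \<Rightarrow> (ennreal \<Rightarrow> 'a measure) \<Rightarrow> ('a \<times> real) measure" where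
  "predictable_sigma P F = sigma (space P \<times> {0..})
     {(\<lambda>(\<omega>, t). X t \<omega>) -` E \<inter> (space P \<times> {0..}) | X E.
        adapted F X \<and> left_continuous P X \<and> E \<in> sets borel}"

definition predictable_process :: "'a measure \<Rightarrow> (ennreal \<Rightarrow> 'a measure) \<Rightarrow> 'a process \<Rightarrow> bool" where
  "predictable_process P F X \<longleftrightarrow> (\<lambda>(\<omega>, t). X t \<omega>) \<in> borel_measurable (predictable_sigma P F)"


section \<open>Classes of processes\<close>

definition stopped :: "'a process \<Rightarrow> ('a \<Rightarrow> ennreal) \<Rightarrow> 'a process" where
  "stopped X T = (\<lambda>t \<omega>. X (enn2real (min (ennreal t) (T \<omega>))) \<omega>)"

definition localized ::
  "'a measure \<Rightarrow> (ennreal \<Rightarrow> 'a measure) \<Rightarrow> 'a process set \<Rightarrow> 'a process set" where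
  "localized P F D = {X. \<exists>T :: nat \<Rightarrow> 'a \<Rightarrow> ennreal.
     (\<forall>n. stopping_time F (T n)) \<and>
     (\<forall>\<omega>\<in>space P. incseq (\<lambda>n. T n \<omega>)) \<and>
     (AE \<omega> in P. (\<lambda>n. T n \<omega>) \<longlonglongrightarrow> \<infinity>) \<and>
     (\<forall>n. stopped X (T n) \<in> D)}"

definition martingales :: "'a measure \<Rightarrow> (ennreal \<Rightarrow> 'a measure) \<Rightarrow> 'a process set" where
  "martingales P F = {X. adapted F X \<and> cadlag P X \<and> (\<forall>t\<ge>0. integrable P (X t)) \<and>
     (\<forall>s t. 0 \<le> s \<longrightarrow> s \<le> t \<longrightarrow>
        (AE \<omega> in P. real_cond_exp P (F (ennreal s)) (X t) \<omega> = X s \<omega>))}"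

text \<open>\<open>X 0\<close> is only required to be \<open>F 0\<close>-measurable, not integrable.\<close>

definition local_martingales :: "'a measure \<Rightarrow> (ennreal \<Rightarrow> 'a measure) \<Rightarrow> 'a process set" where
  "local_martingales P F = {X. adapted F X \<and> cadlag P X \<and>
     (\<lambda>t \<omega>. X t \<omega> - X 0 \<omega>) \<in> localized P F (martingales P F)}"

text \<open>Total variation of a path over \<open>[0,\<infinity>)\<close>.\<close>

definition total_variation :: "(real \<Rightarrow> real) \<Rightarrow> ennreal" where
  "total_variation f =
     (SUP (n, p) \<in> {(n :: nat, p :: nat \<Rightarrow> real). mono p \<and> 0 \<le> p 0}.
        \<Sum>i<n. ennreal \<bar>f (p (Suc i)) - f (p i)\<bar>)"

definition finite_variation_processes ::
  "'a measure \<Rightarrow> (ennreal \<Rightarrow> 'a measure) \<Rightarrow> 'a process set" where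
  "finite_variation_processes P F = {A. adapted F A \<and> cadlag P A \<and>
     (\<forall>\<omega>\<in>space P. \<forall>t\<ge>0. total_variation (\<lambda>s. A (min s t) \<omega>) < \<infinity>)}"

definition integrable_variation_processes ::
  "'a measure \<Rightarrow> (ennreal \<Rightarrow> 'a measure) \<Rightarrow> 'a process set" where
  "integrable_variation_processes P F = {A \<in> finite_variation_processes P F.
     (\<integral>\<^sup>+ \<omega>. total_variation (\<lambda>s. A s \<omega>) \<partial>P) < \<infinity>}"

definition locally_integrable_variation_null ::
  "'a measure \<Rightarrow> (ennreal \<Rightarrow> 'a measure) \<Rightarrow> 'a process set" where
  "locally_integrable_variation_null P F = {A \<in> finite_variation_processes P F.
     (\<forall>\<omega>\<in>space P. A 0 \<omega> = 0) \<and> A \<in> localized P F (integrable_variation_processes P F)}"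

definition special_semimartingales :: "'a measure \<Rightarrow> (ennreal \<Rightarrow> 'a measure) \<Rightarrow> 'a process set" where
  "special_semimartingales P F = {X. adapted F X \<and> cadlag P X \<and>
     (\<exists>M \<in> local_martingales P F. \<exists>A \<in> finite_variation_processes P F.
        predictable_process P F A \<and> (\<forall>\<omega>\<in>space P. A 0 \<omega> = 0) \<and>
        (\<forall>\<omega>\<in>space P. \<forall>t\<ge>0. X t \<omega> = M t \<omega> + A t \<omega>))}"


section \<open>Sets of interval type and processes on them\<close>

definition interval_type :: "'a measure \<Rightarrow> ('a \<times> real) set \<Rightarrow> bool" where
  "interval_type P B \<longleftrightarrow> B \<subseteq> space P \<times> {0..} \<and>
     (\<exists>T :: 'a \<Rightarrow> ennreal. T \<in> borel_measurable P \<and>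
       (\<forall>\<omega>\<in>space P. {t. (\<omega>, t) \<in> B} \<noteq> {} \<and>
          ({t. (\<omega>, t) \<in> B} = {t. 0 \<le> t \<and> ennreal t < T \<omega>} \<or>
           {t. (\<omega>, t) \<in> B} = {t. 0 \<le> t \<and> ennreal t \<le> T \<omega>})))"

definition optional_interval_set ::
  "'a measure \<Rightarrow> (ennreal \<Rightarrow> 'a measure) \<Rightarrow> ('a \<times> real) set \<Rightarrow> bool" where
  "optional_interval_set P F B \<longleftrightarrow> interval_type P B \<and> B \<in> sets (optional_sigma P F)"

definition debut_compl :: "('a \<times> real) set \<Rightarrow> 'a \<Rightarrow> ennreal" where
  "debut_compl B \<omega> = Inf {ennreal t | t. 0 \<le> t \<and> (\<omega>, t) \<notin> B}"

definition closed_stochastic_interval :: "'a measure \<Rightarrow> ('a \<Rightarrow> ennreal) \<Rightarrow> ('a \<times> real) set" where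
  "closed_stochastic_interval P T = {(\<omega>, t). \<omega> \<in> space P \<and> 0 \<le> t \<and> ennreal t \<le> T \<omega>}"

definition restrict_zero :: "('a \<times> real) set \<Rightarrow> 'a process \<Rightarrow> 'a process" where
  "restrict_zero B Y = (\<lambda>t \<omega>. Y t \<omega> * indicator B (\<omega>, t))"

text \<open>
  The class \<open>D\<^sup>B\<close>. A process defined on \<open>B\<close> is represented by a total function whose values off
  \<open>B\<close> are irrelevant. The stopped processes are compared at all \<open>t \<ge> 0\<close>. For processes right
  continuous at \<open>0\<close> on \<open>B\<close> this is the same as comparing them at all \<open>t > 0\<close>; including \<open>t = 0\<close>
  ensures that the initial value on \<open>B\<close> is controlled by \<open>D\<close> (in particular, that it is null for
  processes of locally integrable variation with null initial value).
\<close>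

definition class_on ::
  "'a measure \<Rightarrow> (ennreal \<Rightarrow> 'a measure) \<Rightarrow> 'a process set \<Rightarrow> ('a \<times> real) set \<Rightarrow> 'a process set" where
  "class_on P F D B = {Y. \<exists>(T :: nat \<Rightarrow> 'a \<Rightarrow> ennreal) (Z :: nat \<Rightarrow> 'a process).
     (\<forall>n. stopping_time F (T n)) \<and>
     (\<forall>\<omega>\<in>space P. incseq (\<lambda>n. T n \<omega>) \<and> (\<lambda>n. T n \<omega>) \<longlonglongrightarrow> debut_compl B \<omega>) \<and>
     (\<forall>n. Z n \<in> D) \<and>
     B \<subseteq> (\<Union>n. closed_stochastic_interval P (T n)) \<and>
     (\<forall>n. \<forall>t\<ge>0. \<forall>\<omega>\<in>space P.
        stopped (restrict_zero B Y) (T n) t \<omega> = stopped (restrict_zero B (Z n)) (T n) t \<omega>)}"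

definition indistinguishable_on ::
  "'a measure \<Rightarrow> ('a \<times> real) set \<Rightarrow> 'a process \<Rightarrow> 'a process \<Rightarrow> bool" where
  "indistinguishable_on P B X Y \<longleftrightarrow> (AE \<omega> in P. \<forall>t. (\<omega>, t) \<in> B \<longrightarrow> X t \<omega> = Y t \<omega>)"

definition doob_meyer_on ::
  "'a measure \<Rightarrow> (ennreal \<Rightarrow> 'a measure) \<Rightarrow> ('a \<times> real) set \<Rightarrow>
     'a process \<Rightarrow> 'a process \<Rightarrow> 'a process \<Rightarrow> bool" where
  "doob_meyer_on P F B Y M A \<longleftrightarrow>
     M \<in> class_on P F (local_martingales P F) B \<and>
     A \<in> class_on P F (locally_integrable_variation_null P F) B \<and>
     (\<exists>A'. predictable_process P F A' \<and> (\<forall>(\<omega>, t)\<in>B. A t \<omega> = A' t \<omega>)) \<and>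
     (\<forall>(\<omega>, t)\<in>B. Y t \<omega> = M t \<omega> + A t \<omega>)"

end

theory Submission
  imports Defs
begin

text \<open>
  A fair coin \<open>\<omega> \<in> {0, 1}\<close> is tossed at time 1 and the filtration is trivial before. Kill the
  outcome 1 at time 1, so that \<open>B\<close> is \<open>[0,1[\<close> above \<open>1\<close> and \<open>[0,\<infinity>[\<close> above \<open>0\<close>. The martingale
  that jumps by \<open>1\<close> or \<open>-1\<close> at time 1 only shows its negative jump on \<open>B\<close>, hence coincides there
  with the deterministic process \<open>- indicator {1..}\<close>. So the zero process decomposes
  on \<open>B\<close> both trivially and as this martingale plus \<open>indicator {1..}\<close>.
\<close>

section \<open>The example: coin, filtration, killed set\<close>

definition coin :: "real measure" where
  "coin = uniform_count_measure {0, 1}"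

text \<open>The coin is revealed at time 1 itself, not just after it; this choice makes the
  filtration right continuous.\<close>

definition coin_filtration :: "ennreal \<Rightarrow> real measure" where
  "coin_filtration t = (if t < 1 then sigma {0, 1} {} else count_space {0, 1})"

text \<open>The new value is taken at time 1 already, for right continuity. The value
  \<open>c\<close> also fills the negative times, so that stopping at \<open>\<infinity>\<close>
  changes nothing as a total function.\<close>

definition step :: "real \<Rightarrow> (real \<Rightarrow> real) \<Rightarrow> real process" where
  "step c g = (\<lambda>t \<omega>. if t < 1 then c else g \<omega>)"

definition kill_time :: "real \<Rightarrow> ennreal" where
  "kill_time \<omega> = (if \<omega> = 1 then 1 else \<infinity>)"

text \<open>The strict bound drops time 1 above the outcome 1: this hides the positive jump and
  makes the sections at time 1 tell the outcomes apart.\<close>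

definition kill_set :: "(real \<times> real) set" where
  "kill_set = {(\<omega>, t). \<omega> \<in> {0, 1} \<and> 0 \<le> t \<and> ennreal t < kill_time \<omega>}"

definition toss :: "real \<Rightarrow> real" where
  "toss \<omega> = (if \<omega> = 1 then 1 else -1)"

section \<open>The coin space and the usual conditions\<close>

lemma space_coin [simp]: "space coin = {0, 1}"
  by (simp add: coin_def space_uniform_count_measure)

lemma sets_coin [simp]: "sets coin = Pow {0, 1}"
  by (simp add: coin_def sets_uniform_count_measure)

lemma space_coin_filtration [simp]: "space (coin_filtration t) = {0, 1}"
  by (simp add: coin_filtration_def)

lemma sets_coin_filtration:
  "sets (coin_filtration t) = (if t < 1 then {{}, {0, 1}} else Pow {0, 1})"
  by (auto simp: coin_filtration_def sigma_sets_empty_eq)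

interpretation coin: prob_space coin
  unfolding coin_def by (rule prob_space_uniform_count_measure) auto

text \<open>Each outcome has mass 1/2. Hence completeness is immediate and almost sure statements
  are pointwise ones.\<close>

lemma null_sets_coin: "null_sets coin = {{}}"
proof -
  have "A = {}" if "A \<in> null_sets coin" for A
  proof -
    have "A \<subseteq> {0, 1}" "emeasure coin A = 0"
      using that by (auto simp: null_sets_def)
    then show ?thesis
      by (auto simp: coin_def emeasure_uniform_count_measure finite_subset ennreal_zero_less_divide
          card_eq_0_iff)
  qed
  then show ?thesis by auto
qed

lemma AE_coin: "(AE \<omega> in coin. Q \<omega>) \<longleftrightarrow> Q 0 \<and> Q 1"
  by (auto simp: eventually_ae_filter null_sets_coin)

lemma measurable_coin: "f \<in> borel_measurable coin"
  by (simp add: coin_def uniform_count_measure_def)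

lemma subalgebra_coin_filtration: "subalgebra coin (coin_filtration t)"
  by (auto simp: subalgebra_def sets_coin_filtration)

lemma usual_coin: "usual_filtered_prob_space coin coin_filtration"
proof
  show "A \<in> sets coin" if "A \<subseteq> B" "B \<in> null_sets coin" for A B
    using that by (auto simp: null_sets_coin)
  show "null_sets coin \<subseteq> sets (coin_filtration 0)"
    by (simp add: null_sets_coin)
  show "(\<Inter>s\<in>{t<..}. sets (coin_filtration s)) = sets (coin_filtration t)" if "t < \<infinity>" for t
  proof (cases "t < 1")
    case True
    \<comment> \<open>A single \<open>s\<close> between \<open>t\<close> and 1 already has a trivial
      sigma-algebra, which bounds the whole intersection.\<close>
    then obtain s where "t < s" "s < 1"
      using dense by blast
    then have "(\<Inter>s\<in>{t<..}. sets (coin_filtration s)) \<subseteq> sets (coin_filtration t)"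
      by (auto simp: sets_coin_filtration)
    then show ?thesis
      using True by (auto simp: sets_coin_filtration)
  next
    case False
    then have "sets (coin_filtration s) = Pow {0, 1}" if "t \<le> s" for s
      using that by (auto simp: sets_coin_filtration)
    \<comment> \<open>For \<open>t = \<infinity>\<close> the index set would be empty and the
      intersection would be \<open>UNIV\<close>.\<close>
    moreover have "{t<..} \<noteq> {}"
      using that by (metis empty_iff greaterThan_iff)
    ultimately show ?thesis by simp
  qed
qed (auto simp: subalgebra_coin_filtration sets_coin_filtration)

text \<open>The level set of \<open>f\<close> at the value \<open>f 0\<close> contains 0 and lies in
  the trivial sigma-algebra, so it also contains 1.\<close>

lemma measurable_const_coin_filtration_iff:
  assumes "t < 1"
  shows "f \<in> borel_measurable (coin_filtration t) \<longleftrightarrow> f 0 = (f 1 :: real)"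
proof
  assume f: "f \<in> borel_measurable (coin_filtration t)"
  have "f -` {f 0} \<inter> space (coin_filtration t) \<in> sets (coin_filtration t)"
    using f by (rule measurable_sets) simp
  then have "f -` {f 0} \<inter> {0, 1} \<in> {{}, {0, 1}}"
    using assms by (simp only: sets_coin_filtration space_coin_filtration if_True)
  moreover have "0 \<in> f -` {f 0} \<inter> {0, 1}" by simp
  ultimately have "1 \<in> f -` {f 0}" by blast
  then show "f 0 = f 1" by simp
next
  assume "f 0 = f 1"
  then have const: "f \<omega> = f 0" if "\<omega> \<in> space (coin_filtration t)" for \<omega>
    using that by auto
  show "f \<in> borel_measurable (coin_filtration t)"
    by (rule measurable_cong[THEN iffD2, OF const measurable_const]) auto
qed

lemma measurable_coin_filtration: "1 \<le> t \<Longrightarrow> f \<in> borel_measurable (coin_filtration t)"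
  by (simp add: coin_filtration_def leD)

section \<open>Step processes jumping at time 1\<close>

lemma adapted_step: "adapted coin_filtration (step c g)"
  unfolding adapted_def
proof (intro allI impI)
  fix t :: real assume "0 \<le> t"
  show "step c g t \<in> borel_measurable (coin_filtration (ennreal t))"
  proof (cases "t < 1")
    case True
    then show ?thesis by (simp add: step_def)
  next
    case False
    then have "1 \<le> ennreal t" by simp
    then show ?thesis by (rule measurable_coin_filtration)
  qed
qed

lemma cadlag_step: "cadlag P (step c g)"
  unfolding cadlag_def
proof (intro ballI conjI allI impI)
  fix \<omega> and t :: real
  have "\<forall>\<^sub>F s in at_right t. step c g s \<omega> = step c g t \<omega>"
  proof (cases "t < 1")
    case True
    then show ?thesis
      unfolding eventually_at_right[OF True] by (auto simp: step_def)
  next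
    case False
    then show ?thesis
      by (auto simp: step_def eventually_at_filter)
  qed
  then show "continuous (at_right t) (\<lambda>s. step c g s \<omega>)"
    unfolding continuous_within by (rule tendsto_eventually)
  \<comment> \<open>The left limit at \<open>t = 1\<close> is still \<open>c\<close>, hence the
    non-strict comparison.\<close>
  have "\<forall>\<^sub>F s in at_left t. step c g s \<omega> = (if t \<le> 1 then c else g \<omega>)"
  proof (cases "t \<le> 1")
    case True
    then show ?thesis
      by (auto simp: step_def eventually_at_filter)
  next
    case False
    then have "1 < t" by simp
    then show ?thesis
      unfolding eventually_at_left[OF \<open>1 < t\<close>] by (intro exI[of _ 1]) (auto simp: step_def)
  qed
  then show "\<exists>l. ((\<lambda>s. step c g s \<omega>) \<longlongrightarrow> l) (at_left t)"
    by (intro exI) (rule tendsto_eventually)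
qed

section \<open>Localization by the constant sequence \<open>\<infinity>\<close>\<close>

lemma stopped_infinity:
  assumes "\<And>t. t < 0 \<Longrightarrow> X t = X 0"
  shows "stopped X (\<lambda>_. \<infinity>) = X"
proof -
  \<comment> \<open>\<open>ennreal\<close> sends negative times to 0, where the assumption on
    \<open>X\<close> takes over.\<close>
  have "X (enn2real (ennreal t)) = X t" for t
    using assms[of t] by (cases "0 \<le> t") (auto simp: ennreal_neg)
  then show ?thesis
    by (simp add: stopped_def)
qed

lemma localizedI:
  assumes "X \<in> D" "\<And>t. t < 0 \<Longrightarrow> X t = X 0"
  shows "X \<in> localized P F D"
  unfolding localized_def using assms
  by (auto intro!: exI[of _ "\<lambda>_ _. \<infinity>"] simp: stopped_infinity[unfolded infinity_ennreal_def] incseq_def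
      stopping_time_def)

section \<open>The killing time and classes of processes on the killed set\<close>

lemma stopping_time_kill_time: "stopping_time coin_filtration kill_time"
  \<comment> \<open>Before time 1 the event of having been killed is empty; from time 1 on every
    event is measurable.\<close>
  unfolding stopping_time_def pred_def
  by (auto simp: kill_time_def sets_coin_filtration top_unique not_less)

lemma debut_compl_kill_set:
  assumes "\<omega> \<in> {0, 1}"
  shows "debut_compl kill_set \<omega> = kill_time \<omega>"
proof (cases "\<omega> = 1")
  case True
  then have "{ennreal t |t. 0 \<le> t \<and> (\<omega>, t) \<notin> kill_set} = {ennreal t |t. 1 \<le> t}"
    by (auto simp: kill_set_def kill_time_def not_less)
  moreover have "Inf {ennreal t |t. 1 \<le> t} = 1"
    by (rule antisym) (auto intro!: Inf_lower Inf_greatest exI[of _ 1])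
  ultimately show ?thesis
    using True by (simp add: debut_compl_def kill_time_def)
next
  case False
  \<comment> \<open>The path above 0 never leaves the set, and the infimum of the empty set is
    \<open>\<infinity>\<close>.\<close>
  then have empty: "{ennreal t |t. 0 \<le> t \<and> (\<omega>, t) \<notin> kill_set} = {}"
    using assms by (auto simp: kill_set_def kill_time_def)
  show ?thesis
    unfolding debut_compl_def empty using False by (simp add: kill_time_def)
qed

text \<open>The debut of the complement is itself a stopping time, so \<open>T n = kill_time\<close>
  and \<open>Z n = Y\<close> for all \<open>n\<close> serve as witnesses.\<close>

lemma class_on_kill_set:
  assumes "Y \<in> D"
  shows "Y \<in> class_on coin coin_filtration D kill_set"
proof -
  have "kill_set \<subseteq> closed_stochastic_interval coin kill_time"
    by (auto simp: closed_stochastic_interval_def kill_set_def)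
  moreover have "(\<lambda>n. kill_time \<omega>) \<longlonglongrightarrow> debut_compl kill_set \<omega>" if "\<omega> \<in> space coin" for \<omega>
    using debut_compl_kill_set that by simp
  ultimately show ?thesis
    unfolding class_on_def using assms stopping_time_kill_time
    by (intro CollectI exI[of _ "\<lambda>_. kill_time"] exI[of _ "\<lambda>_. Y"]) (simp add: incseq_def)
qed

lemma step_left: "t < 0 \<Longrightarrow> step c g t = step c g 0"
  by (simp add: step_def fun_eq_iff)

section \<open>Optionality and non-predictability of the killed set\<close>

lemma optional_interval_kill_set: "optional_interval_set coin coin_filtration kill_set"
  unfolding optional_interval_set_def
proof
  show "interval_type coin kill_set"
    unfolding interval_type_def
    by (rule conjI, force simp: kill_set_def, rule exI[of _ kill_time])
      (force simp: kill_set_def kill_time_def measurable_coin intro!: exI[of _ 0])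
  \<comment> \<open>On nonnegative times this is the indicator of \<open>kill_set\<close>, an
    adapted cadlag process.\<close>
  let ?X = "step 1 (\<lambda>\<omega>. if \<omega> = 1 then 0 else 1)"
  have "kill_set = (\<lambda>(\<omega>, t). ?X t \<omega>) -` {1} \<inter> (space coin \<times> {0..})"
    by (auto simp: kill_set_def kill_time_def step_def split: if_splits)
  then have "kill_set \<in> {(\<lambda>(\<omega>, t). X t \<omega>) -` E \<inter> (space coin \<times> {0..}) | X E.
      adapted coin_filtration X \<and> cadlag coin X \<and> E \<in> sets borel}"
    using adapted_step cadlag_step by (intro CollectI exI[of _ ?X] exI[of _ "{1}"]) simp
  then show "kill_set \<in> sets (optional_sigma coin coin_filtration)"
    unfolding optional_sigma_def by (intro in_measure_of) auto
qed

text \<open>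
  An adapted process does not depend on the coin before time 1; by left continuity it does not
  depend on it at time 1 either.
\<close>

lemma predictable_sigma_at_1:
  assumes "C \<in> sets (predictable_sigma coin coin_filtration)"
  shows "(0, 1) \<in> C \<longleftrightarrow> (1, 1) \<in> C"
proof -
  define G where "G = {(\<lambda>(\<omega>, t). X t \<omega>) -` E \<inter> (space coin \<times> {0..}) | X E.
        adapted coin_filtration X \<and> left_continuous coin X \<and> E \<in> sets (borel :: real measure)}"
  have "G \<subseteq> Pow (space coin \<times> {0..})"
    unfolding G_def by auto
  then have "C \<in> sigma_sets (space coin \<times> {0..}) G"
    using assms unfolding predictable_sigma_def G_def[symmetric] by (simp add: sets_measure_of)
  \<comment> \<open>Agreement of the two outcomes at time 1 passes to complements and countable
    unions, so only the generators need an argument.\<close>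
  then show ?thesis
  proof induction
    case (Basic C)
    then obtain X E where C: "C = (\<lambda>(\<omega>, t). X t \<omega>) -` E \<inter> (space coin \<times> {0..})"
      and X: "adapted coin_filtration X" "left_continuous coin X"
      unfolding G_def by auto
    have eq: "X s 0 = X s 1" if "0 \<le> s" "s < 1" for s
    proof (rule measurable_const_coin_filtration_iff[THEN iffD1])
      show "ennreal s < 1"
        using that by simp
      show "X s \<in> borel_measurable (coin_filtration (ennreal s))"
        using X(1) that unfolding adapted_def by blast
    qed
    have lim: "((\<lambda>s. X s \<omega>) \<longlongrightarrow> X 1 \<omega>) (at_left 1)" if "\<omega> \<in> {0, 1}" for \<omega>
    proof -
      have "continuous (at_left 1) (\<lambda>s. X s \<omega>)"
        using X(2) that by (simp only: left_continuous_def space_coin zero_less_one)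
      then show ?thesis
        by (simp only: continuous_within)
    qed
    have "\<forall>\<^sub>F s in at_left (1::real). X s 0 = X s 1"
      by (rule eventually_at_leftI[of 0]) (auto intro: eq)
    \<comment> \<open>The two paths agree just before time 1, so the path above 1 also tends to
      \<open>X 1 0\<close>; uniqueness of the limit identifies the two values.\<close>
    then have "((\<lambda>s. X s 1) \<longlongrightarrow> X 1 0) (at_left 1)"
      by (rule Lim_transform_eventually[rotated]) (rule lim, simp)
    moreover have "((\<lambda>s. X s 1) \<longlongrightarrow> X 1 1) (at_left 1)"
      by (rule lim) simp
    ultimately have "X 1 0 = X 1 1"
      by (rule tendsto_unique[OF trivial_limit_at_left_real])
    then show ?case
      by (auto simp: C)
  qed auto
qed

text \<open>At time 1 the set contains the outcome 0 but not the outcome 1.\<close>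

lemma kill_set_not_predictable: "kill_set \<notin> sets (predictable_sigma coin coin_filtration)"
  using predictable_sigma_at_1[of kill_set] by (auto simp: kill_set_def kill_time_def)

section \<open>Martingales and local martingales\<close>

lemma step_martingale:
  assumes "g 0 + g 1 = 0"
  shows "step 0 g \<in> martingales coin coin_filtration"
proof -
  have int: "integrable coin f" for f :: "real \<Rightarrow> real"
    unfolding coin_def uniform_count_measure_def by (rule integrable_point_measure_finite) simp
  have g_integral: "(\<integral>\<omega>. g \<omega> \<partial>coin) = 0"
    using assms by (simp add: coin_def integral_uniform_count_measure)
  have "AE \<omega> in coin. real_cond_exp coin (coin_filtration (ennreal s)) (step 0 g t) \<omega> = step 0 g s \<omega>"
    if "0 \<le> s" "s \<le> t" for s t
  proof -
    interpret S: finite_measure_subalgebra coin "coin_filtration (ennreal s)"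
      by unfold_locales (rule subalgebra_coin_filtration)
    have s: "step 0 g s \<in> borel_measurable (coin_filtration (ennreal s))"
      using adapted_step that unfolding adapted_def by blast
    show ?thesis
    proof (rule S.real_cond_exp_charact)
      fix A assume A: "A \<in> sets (coin_filtration (ennreal s))"
      show "(\<integral>\<omega>\<in>A. step 0 g t \<omega> \<partial>coin) = (\<integral>\<omega>\<in>A. step 0 g s \<omega> \<partial>coin)"
      \<comment> \<open>Only an interval containing the jump matters. There the sigma-algebra at
        \<open>s\<close> is trivial, so the test sets are empty or the whole space, and
        \<open>g\<close> has mean zero.\<close>
      proof (cases "s < 1 \<and> 1 \<le> t")
        case True
        then have "A = {} \<or> A = space coin"
          using A that by (auto simp: sets_coin_filtration)
        then have "(\<integral>\<omega>\<in>A. g \<omega> \<partial>coin) = 0"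
        proof
          assume "A = {}"
          then show ?thesis by (simp add: set_lebesgue_integral_def)
        next
          assume "A = space coin"
          then show ?thesis by (simp only: set_integral_space[OF int] g_integral)
        qed
        then show ?thesis
          using True by (simp add: step_def set_lebesgue_integral_def)
      next
        case False
        then have "step 0 g s = step 0 g t"
          using that by (auto simp: step_def)
        then show ?thesis by simp
      qed
    qed (rule int, rule int, rule s)
  qed
  then show ?thesis
    unfolding martingales_def using adapted_step cadlag_step int by blast
qed

text \<open>The null value at 0 makes subtracting \<open>X 0\<close> harmless, and the null values
  at negative times allow localization by \<open>\<infinity>\<close>.\<close>

lemma local_martingalesI:
  assumes "X \<in> martingales P F" "\<And>t. t \<le> 0 \<Longrightarrow> X t = (\<lambda>_. 0)"
  shows "X \<in> local_martingales P F"
proof -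
  have "(\<lambda>t \<omega>. X t \<omega> - X 0 \<omega>) = X"
    using assms(2)[of 0] by simp
  moreover have "X \<in> localized P F (martingales P F)"
    using assms by (intro localizedI) auto
  ultimately show ?thesis
    using assms(1) by (simp add: local_martingales_def martingales_def)
qed

section \<open>Variation of monotone paths and of constant steps\<close>

lemma total_variation_mono_le:
  fixes f :: "real \<Rightarrow> real"
  assumes "mono f" "\<And>s. a \<le> f s" "\<And>s. f s \<le> b"
  shows "total_variation f \<le> ennreal (b - a)"
  unfolding total_variation_def
proof (rule SUP_least, clarify)
  fix n and p :: "nat \<Rightarrow> real"
  assume "mono p"
  \<comment> \<open>Nonnegative increments remove the absolute values, after which the sum
    telescopes.\<close>
  have incr: "f (p i) \<le> f (p (Suc i))" for i
    by (rule monoD[OF \<open>mono f\<close>], rule monoD[OF \<open>mono p\<close>]) simp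
  have "(\<Sum>i<n. ennreal \<bar>f (p (Suc i)) - f (p i)\<bar>) = ennreal (\<Sum>i<n. f (p (Suc i)) - f (p i))"
    using incr by (subst sum_ennreal[symmetric]) (auto simp: abs_of_nonneg)
  also have "\<dots> = ennreal (f (p n) - f (p 0))"
    by (simp only: sum_lessThan_telescope[of "\<lambda>i. f (p i)"])
  also have "\<dots> \<le> ennreal (b - a)"
    using assms(2,3)[of "p _"] by (intro ennreal_leI diff_mono)
  finally show "(\<Sum>i<n. ennreal \<bar>f (p (Suc i)) - f (p i)\<bar>) \<le> ennreal (b - a)" .
qed

lemma step_const_finite_variation:
  assumes "0 \<le> c"
  shows "step 0 (\<lambda>_. c) \<in> finite_variation_processes P coin_filtration"
proof -
  have "total_variation (\<lambda>s. step 0 (\<lambda>_. c) (min s t) \<omega>) \<le> ennreal (c - 0)" for t \<omega>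
    using assms by (intro total_variation_mono_le) (auto simp: step_def mono_def)
  then have "total_variation (\<lambda>s. step 0 (\<lambda>_. c) (min s t) \<omega>) < \<infinity>" for t \<omega>
    using ennreal_less_top le_less_trans unfolding infinity_ennreal_def by blast
  then show ?thesis
    by (simp add: finite_variation_processes_def adapted_step cadlag_step)
qed

lemma step_const_locally_integrable_variation:
  assumes "0 \<le> c"
  shows "step 0 (\<lambda>_. c) \<in> locally_integrable_variation_null coin coin_filtration"
proof -
  have "total_variation (\<lambda>s. step 0 (\<lambda>_. c) s \<omega>) \<le> ennreal (c - 0)" for \<omega>
    using assms by (intro total_variation_mono_le) (auto simp: step_def mono_def)
  then have "(\<integral>\<^sup>+ \<omega>. total_variation (\<lambda>s. step 0 (\<lambda>_. c) s \<omega>) \<partial>coin) \<le> (\<integral>\<^sup>+ \<omega>. ennreal c \<partial>coin)"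
    by (intro nn_integral_mono) simp
  also have "\<dots> < \<infinity>"
    by (simp add: coin.emeasure_space_1[simplified])
  finally have "step 0 (\<lambda>_. c) \<in> integrable_variation_processes coin coin_filtration"
    using step_const_finite_variation[OF assms] by (simp add: integrable_variation_processes_def)
  then have "step 0 (\<lambda>_. c) \<in> localized coin coin_filtration (integrable_variation_processes coin coin_filtration)"
    by (rule localizedI) (rule step_left)
  moreover have "step 0 (\<lambda>_. c) 0 \<omega> = 0" for \<omega>
    by (simp add: step_def)
  ultimately show ?thesis
    using step_const_finite_variation[OF assms]
    by (simp add: locally_integrable_variation_null_def)
qed

section \<open>Predictability of deterministic steps\<close>

lemma left_continuous_predictable:
  assumes "adapted F X" "left_continuous P X"
  shows "predictable_process P F X"
  unfolding predictable_process_def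
proof (rule measurableI)
  define G where "G = {(\<lambda>(\<omega>, t). X t \<omega>) -` E \<inter> (space P \<times> {0..}) | X E.
        adapted F X \<and> left_continuous P X \<and> E \<in> sets (borel :: real measure)}"
  have G: "G \<subseteq> Pow (space P \<times> {0..})"
    unfolding G_def by auto
  fix E :: "real set"
  assume "E \<in> sets borel"
  with assms have "(\<lambda>(\<omega>, t). X t \<omega>) -` E \<inter> (space P \<times> {0..}) \<in> G"
    unfolding G_def by blast
  then show "(\<lambda>(\<omega>, t). X t \<omega>) -` E \<inter> space (predictable_sigma P F) \<in> sets (predictable_sigma P F)"
    unfolding predictable_sigma_def G_def[symmetric] space_measure_of[OF G] by (intro in_measure_of G)
qed simp

lemma step_const_predictable: "predictable_process P coin_filtration (step 0 (\<lambda>_. c))"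
proof -
  \<comment> \<open>The right-continuous step at 1 is the limit of left-continuous steps at \<open>1 - 1/n\<close>.\<close>
  define X where "X n = (\<lambda>t (\<omega>::real). if t \<le> 1 - 1 / real (Suc n) then 0 else c)" for n
  have X: "(\<lambda>(\<omega>, t). X n t \<omega>) \<in> borel_measurable (predictable_sigma P coin_filtration)" for n
  proof -
    \<comment> \<open>\<open>X n\<close> is deterministic, hence adapted although it jumps before
      the coin is revealed.\<close>
    have "adapted coin_filtration (X n)"
      by (simp add: adapted_def X_def)
    moreover have "left_continuous P (X n)"
      unfolding left_continuous_def
    proof (intro ballI allI impI)
      fix \<omega> and t :: real
      have "\<forall>\<^sub>F s in at_left t. X n s \<omega> = X n t \<omega>"
      proof (cases "t \<le> 1 - 1 / real (Suc n)")
        case True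
        then show ?thesis
          by (auto simp: X_def eventually_at_filter)
      next
        case False
        then have "1 - 1 / real (Suc n) < t" by simp
        then show ?thesis
          by (rule eventually_at_leftI[rotated]) (auto simp: X_def)
      qed
      then show "continuous (at_left t) (\<lambda>s. X n s \<omega>)"
        unfolding continuous_within by (rule tendsto_eventually)
    qed
    ultimately show ?thesis
      using left_continuous_predictable unfolding predictable_process_def by blast
  qed
  have "(\<lambda>n. X n t \<omega>) \<longlonglongrightarrow> step 0 (\<lambda>_. c) t \<omega>" for t \<omega>
  proof (cases "t < 1")
    case True
    have "\<forall>\<^sub>F n in sequentially. t < 1 - 1 / real (Suc n)"
      using order_tendstoD(1)[OF LIMSEQ_inverse_real_of_nat_add_minus[of 1] True]
      by (simp add: inverse_eq_divide)
    then have "\<forall>\<^sub>F n in sequentially. X n t \<omega> = step 0 (\<lambda>_. c) t \<omega>"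
      by eventually_elim (use True in \<open>simp add: X_def step_def\<close>)
    then show ?thesis by (rule tendsto_eventually)
  next
    case False
    \<comment> \<open>All jump times lie strictly below 1, so every \<open>X n\<close> has already
      reached \<open>c\<close> at time 1.\<close>
    then have "\<not> t \<le> 1 - 1 / real (Suc n)" for n
      by (simp add: not_le order.strict_trans2[of _ 1])
    then show ?thesis
      using False by (simp add: X_def step_def)
  qed
  then show ?thesis
    unfolding predictable_process_def
    by (intro borel_measurable_LIMSEQ_real[OF _ X]) auto
qed

section \<open>Two decompositions of the zero process\<close>

theorem mainTheorem3:
  "\<exists>(P :: real measure) (F :: ennreal \<Rightarrow> real measure) (B :: (real \<times> real) set) Y M A M' A'.
     usual_filtered_prob_space P F \<and>
     optional_interval_set P F B \<and>
     B \<notin> sets (predictable_sigma P F) \<and>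
     Y \<in> class_on P F (special_semimartingales P F) B \<and>
     doob_meyer_on P F B Y M A \<and>
     doob_meyer_on P F B Y M' A' \<and>
     \<not> (indistinguishable_on P B M M' \<and> indistinguishable_on P B A A')"
proof (intro exI conjI)
  \<comment> \<open>The zero process is written as a step so that the lemmas on steps cover it as
    well.\<close>
  let ?Z = "step 0 (\<lambda>_. 0)" and ?M = "step 0 toss" and ?A = "step 0 (\<lambda>_. 1)"
  have lm: "step 0 g \<in> local_martingales coin coin_filtration" if "g 0 + g 1 = 0" for g
    using that by (intro local_martingalesI step_martingale) (auto simp: step_def)
  have toss: "toss 0 + toss 1 = 0"
    by (simp add: toss_def)
  show "usual_filtered_prob_space coin coin_filtration"
    by (rule usual_coin)
  show "optional_interval_set coin coin_filtration kill_set"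
    by (rule optional_interval_kill_set)
  show "kill_set \<notin> sets (predictable_sigma coin coin_filtration)"
    by (rule kill_set_not_predictable)
  have "?Z \<in> special_semimartingales coin coin_filtration"
    unfolding special_semimartingales_def
    by (intro CollectI conjI bexI[of _ ?Z] adapted_step cadlag_step step_const_predictable
        step_const_finite_variation lm) (auto simp: step_def)
  then show "?Z \<in> class_on coin coin_filtration (special_semimartingales coin coin_filtration) kill_set"
    by (rule class_on_kill_set)
  show "doob_meyer_on coin coin_filtration kill_set ?Z ?Z ?Z"
    unfolding doob_meyer_on_def
    by (intro conjI class_on_kill_set lm step_const_locally_integrable_variation exI[of _ ?Z]
        step_const_predictable) (auto simp: step_def)
  \<comment> \<open>In \<open>kill_set\<close> times from 1 on occur only above the outcome 0, where
    \<open>toss\<close> is -1 and cancels \<open>?A\<close>.\<close>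
  have "?Z t \<omega> = ?M t \<omega> + ?A t \<omega>" if "(\<omega>, t) \<in> kill_set" for \<omega> t
    using that by (auto simp: kill_set_def kill_time_def step_def toss_def split: if_splits)
  then show "doob_meyer_on coin coin_filtration kill_set ?Z ?M ?A"
    unfolding doob_meyer_on_def
    by (intro conjI class_on_kill_set lm toss step_const_locally_integrable_variation exI[of _ ?A]
        step_const_predictable) auto
  \<comment> \<open>At this point \<open>?M\<close> is -1 and \<open>?A\<close> is 1, and the
    outcome 0 has positive mass.\<close>
  have "(0, 1) \<in> kill_set"
    by (simp add: kill_set_def kill_time_def)
  then show "\<not> (indistinguishable_on coin kill_set ?Z ?M \<and> indistinguishable_on coin kill_set ?Z ?A)"
    unfolding indistinguishable_on_def AE_coin by (auto simp: step_def intro!: exI[of _ 1])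
qed

end
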